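(* Let $G$ be a finite simple graph, let $s\ge 1$, let $e_1,\ldots,e_s\in E(G)$ (not necessarily distinct), and let $G'$ be the graph associated to the polarization $\widetilde{(I(G)^{s+1} : e_1\cdots e_s)}$. Then $\nu(G') \leq \nu(G)$.
   Context: Graphs are finite, simple and undirected. For a graph $G$ with vertex set $\{x_1,\ldots,x_n\}$ and a field $k$, the edge ideal is $I(G) = (x_ix_j \mid \{x_i,x_j\}\in E(G)) \subseteq k[x_1,\ldots,x_n]$. An edge $e=\{x_i,x_j\}$ is identified with the monomial $x_ix_j$. The polarization of a monomial $x_1^{m_1}\cdots x_n^{m_n}$ is the squarefree monomial $x_{11}\cdots x_{1m_1}x_{21}\cdots x_{2m_2}\cdots x_{n1}\cdots x_{nm_n}$ in a larger polynomial ring, and the polarization $\widetilde{I}$ of a monomial ideal $I$ is generated by the polarizations of its minimal monomial generators ($x_{i1}$ being identified with $x_i$). By a theorem of Banerjee, $(I(G)^{s+1}:e_1\cdots e_s)$ is minimally generated by monomials of degree 2 (possibly squares $x_i^2$), so its polarization is a squarefree quadratic monomial ideal and hence is the edge ideal of a graph $G'$, whose vertices are those of $G$ together with one new vertex for each generator $x_i^2$ (polarized as $x_i$ times the new variable); $G$ is a subgraph of $G'$. The induced matching number $\nu(G)$ is the largest size of an induced matching in $G$, i.e. of a set of pairwise disjoint edges such that no edge of $G$ joins endpoints of two different edges in the set. *)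

theory Defs
  imports "HOL-Library.Poly_Mapping" "HOL-Algebra.Ideal_Product"
begin

section \<open>Finite simple graphs and induced matchings\<close>

record 'v ugraph =
  verts :: "'v set"
  edges :: "'v set set"

definition simple_graph :: "'v ugraph \<Rightarrow> bool" where
  "simple_graph G \<longleftrightarrow> finite (verts G) \<and> (\<forall>e\<in>edges G. e \<subseteq> verts G \<and> card e = 2)"

definition induced_matching :: "'v ugraph \<Rightarrow> 'v set set \<Rightarrow> bool" where
  "induced_matching G M \<longleftrightarrow>
     M \<subseteq> edges G \<and>
     (\<forall>e\<in>M. \<forall>f\<in>M. e \<noteq> f \<longrightarrow>
        e \<inter> f = {} \<and> (\<forall>x\<in>e. \<forall>y\<in>f. {x, y} \<notin> edges G))"

definition induced_matching_number :: "'v ugraph \<Rightarrow> nat" where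
  "induced_matching_number G = Max {card M | M. induced_matching G M}"


section \<open>Polynomial rings and monomial ideals\<close>

text \<open>A monomial is given by its exponent vector, of type \<^typ>\<open>'v \<Rightarrow>\<^sub>0 nat\<close>, and a polynomial
  is a finitely supported family of coefficients indexed by monomials. The ring
  \<open>poly_ring X\<close> consists of those polynomials that involve only variables from \<open>X\<close>.\<close>

definition poly_ring :: "'v set \<Rightarrow> (('v \<Rightarrow>\<^sub>0 nat) \<Rightarrow>\<^sub>0 'k::comm_ring_1) ring" where
  "poly_ring X =
     \<lparr> carrier = {p. \<forall>m\<in>Poly_Mapping.keys p. Poly_Mapping.keys m \<subseteq> X},
       mult = (*), one = 1, zero = 0, add = (+) \<rparr>"

definition monomial :: "('v \<Rightarrow>\<^sub>0 nat) \<Rightarrow> (('v \<Rightarrow>\<^sub>0 nat) \<Rightarrow>\<^sub>0 'k::comm_ring_1)" where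
  "monomial m = Poly_Mapping.single m 1"

definition var :: "'v \<Rightarrow> (('v \<Rightarrow>\<^sub>0 nat) \<Rightarrow>\<^sub>0 'k::comm_ring_1)" where
  "var v = monomial (Poly_Mapping.single v 1)"

definition mon_dvd :: "('v \<Rightarrow>\<^sub>0 nat) \<Rightarrow> ('v \<Rightarrow>\<^sub>0 nat) \<Rightarrow> bool" where
  "mon_dvd m n \<longleftrightarrow> (\<forall>v. Poly_Mapping.lookup m v \<le> Poly_Mapping.lookup n v)"

text \<open>The exponent vectors of the minimal monomial generators of a monomial ideal: the
  monomials in the ideal that are minimal with respect to divisibility.\<close>

definition min_gens :: "(('v \<Rightarrow>\<^sub>0 nat) \<Rightarrow>\<^sub>0 'k::comm_ring_1) set \<Rightarrow> ('v \<Rightarrow>\<^sub>0 nat) set" where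
  "min_gens I = {m. monomial m \<in> I \<and> (\<forall>n. monomial n \<in> I \<longrightarrow> mon_dvd n m \<longrightarrow> n = m)}"

definition ideal_power :: "('a, 'b) ring_scheme \<Rightarrow> 'a set \<Rightarrow> nat \<Rightarrow> 'a set" where
  "ideal_power R I n = I [^]\<^bsub>ideals_set R\<^esub> n"

definition ideal_colon :: "('a, 'b) ring_scheme \<Rightarrow> 'a set \<Rightarrow> 'a \<Rightarrow> 'a set" where
  "ideal_colon R I g = {f \<in> carrier R. f \<otimes>\<^bsub>R\<^esub> g \<in> I}"


section \<open>Edge ideals\<close>

definition edge_mon :: "'v set \<Rightarrow> (('v \<Rightarrow>\<^sub>0 nat) \<Rightarrow>\<^sub>0 'k::comm_ring_1)" where
  "edge_mon e = (\<Prod>v\<in>e. var v)"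

definition edge_ideal :: "'v ugraph \<Rightarrow> (('v \<Rightarrow>\<^sub>0 nat) \<Rightarrow>\<^sub>0 'k::comm_ring_1) set" where
  "edge_ideal G = genideal (poly_ring (verts G)) (edge_mon ` edges G)"

text \<open>The graph on the vertex set \<open>X\<close> whose edge ideal is the squarefree quadratic monomial
  ideal \<open>J\<close> of \<open>poly_ring X\<close>: its edges are the minimal generators of \<open>J\<close>. The lemma
  \<open>graph_of_ideal_edge_ideal\<close> below shows that this recovers a graph from its edge ideal, so
  the graph with edge ideal \<open>J\<close> is unique and is given by \<open>graph_of_ideal\<close>.\<close>

definition graph_of_ideal ::
    "'v set \<Rightarrow> (('v \<Rightarrow>\<^sub>0 nat) \<Rightarrow>\<^sub>0 'k::comm_ring_1) set \<Rightarrow> 'v ugraph" where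
  "graph_of_ideal X J =
     \<lparr> verts = X,
       edges = {{u, v} | u v. u \<noteq> v \<and>
                  Poly_Mapping.single u 1 + Poly_Mapping.single v 1 \<in> min_gens J} \<rparr>"


section \<open>Polarization\<close>

text \<open>The variable \<open>x\<^bsub>ij\<^esub>\<close> of the larger ring is the pair of \<open>x\<^sub>i\<close> and \<open>j \<ge> 1\<close>; the original
  variable \<open>x\<^sub>i\<close> corresponds to the pair with \<open>j = 1\<close>.\<close>

definition polarize :: "('v \<Rightarrow>\<^sub>0 nat) \<Rightarrow> ('v \<times> nat \<Rightarrow>\<^sub>0 nat)" where
  "polarize m = (\<Sum>v\<in>Poly_Mapping.keys m.
                   \<Sum>j=1..Poly_Mapping.lookup m v. Poly_Mapping.single (v, j) 1)"

text \<open>The variables of the larger ring: the original ones, together with the new ones that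
  occur in the polarizations of the minimal generators.\<close>

definition polar_vars ::
    "'v set \<Rightarrow> (('v \<Rightarrow>\<^sub>0 nat) \<Rightarrow>\<^sub>0 'k::comm_ring_1) set \<Rightarrow> ('v \<times> nat) set" where
  "polar_vars X I = X \<times> {1} \<union> (\<Union>m\<in>min_gens I. Poly_Mapping.keys (polarize m))"

definition polarization ::
    "'v set \<Rightarrow> (('v \<Rightarrow>\<^sub>0 nat) \<Rightarrow>\<^sub>0 'k::comm_ring_1) set \<Rightarrow> (('v \<times> nat \<Rightarrow>\<^sub>0 nat) \<Rightarrow>\<^sub>0 'k) set" where
  "polarization X I =
     genideal (poly_ring (polar_vars X I)) ((\<lambda>m. monomial (polarize m)) ` min_gens I)"


section \<open>Recovering a graph from its edge ideal\<close>

lemma poly_ring_sel [simp]: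
  "carrier (poly_ring X) = {p. \<forall>m\<in>Poly_Mapping.keys p. Poly_Mapping.keys m \<subseteq> X}"
  "p \<otimes>\<^bsub>poly_ring X\<^esub> q = p * q" "p \<oplus>\<^bsub>poly_ring X\<^esub> q = p + q"
  "\<one>\<^bsub>poly_ring X\<^esub> = 1" "\<zero>\<^bsub>poly_ring X\<^esub> = 0"
  by (simp_all add: poly_ring_def)

lemma keys_add_nat:
  "Poly_Mapping.keys (m + n :: 'v \<Rightarrow>\<^sub>0 nat) = Poly_Mapping.keys m \<union> Poly_Mapping.keys n"
  by (auto simp: in_keys_iff lookup_add)

lemma keys_mult_ex:
  assumes "m \<in> Poly_Mapping.keys (p * q)"
  shows "\<exists>a\<in>Poly_Mapping.keys p. \<exists>b\<in>Poly_Mapping.keys q. m = a + b"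
  using subsetD[OF keys_mult assms] by blast

lemma keys_uminus_poly: "Poly_Mapping.keys (- p) = Poly_Mapping.keys (p :: 'a \<Rightarrow>\<^sub>0 'k::ab_group_add)"
  by (auto simp: in_keys_iff)

lemma cring_poly_ring: "cring (poly_ring X :: (('v \<Rightarrow>\<^sub>0 nat) \<Rightarrow>\<^sub>0 'k::comm_ring_1) ring)"
proof (rule cringI)
  show "abelian_group (poly_ring X :: (('v \<Rightarrow>\<^sub>0 nat) \<Rightarrow>\<^sub>0 'k) ring)"
  proof (rule abelian_groupI)
    fix p :: "('v \<Rightarrow>\<^sub>0 nat) \<Rightarrow>\<^sub>0 'k" assume "p \<in> carrier (poly_ring X)"
    then show "\<exists>q\<in>carrier (poly_ring X). q \<oplus>\<^bsub>poly_ring X\<^esub> p = \<zero>\<^bsub>poly_ring X\<^esub>"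
      by (intro bexI[of _ "- p"]) (auto simp: keys_uminus_poly)
  next
    fix p q :: "('v \<Rightarrow>\<^sub>0 nat) \<Rightarrow>\<^sub>0 'k"
    assume "p \<in> carrier (poly_ring X)" "q \<in> carrier (poly_ring X)"
    then show "p \<oplus>\<^bsub>poly_ring X\<^esub> q \<in> carrier (poly_ring X)"
      using Poly_Mapping.keys_add[of p q] by auto
  qed (auto simp: algebra_simps)
  show "comm_monoid (poly_ring X :: (('v \<Rightarrow>\<^sub>0 nat) \<Rightarrow>\<^sub>0 'k) ring)"
  proof (rule comm_monoidI)
    fix p q :: "('v \<Rightarrow>\<^sub>0 nat) \<Rightarrow>\<^sub>0 'k"
    assume pq: "p \<in> carrier (poly_ring X)" "q \<in> carrier (poly_ring X)"
    show "p \<otimes>\<^bsub>poly_ring X\<^esub> q \<in> carrier (poly_ring X)"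
    proof (simp, rule ballI)
      fix m assume "m \<in> Poly_Mapping.keys (p * q)"
      from keys_mult_ex[OF this] show "Poly_Mapping.keys m \<subseteq> X"
        using pq by (force simp: keys_add_nat)
    qed
  qed (auto simp: algebra_simps)
qed (auto simp: algebra_simps)

lemma mon_in_genidealD:
  assumes gens: "\<forall>m\<in>B. Poly_Mapping.keys m \<subseteq> X"
    and mem: "(monomial n :: ('v \<Rightarrow>\<^sub>0 nat) \<Rightarrow>\<^sub>0 'k::comm_ring_1) \<in> genideal (poly_ring X) (monomial ` B)"
  shows "\<exists>m\<in>B. mon_dvd m n"
proof -
  let ?R = "poly_ring X :: (('v \<Rightarrow>\<^sub>0 nat) \<Rightarrow>\<^sub>0 'k) ring"
  let ?I = "{p \<in> carrier ?R. \<forall>n\<in>Poly_Mapping.keys p. \<exists>m\<in>B. mon_dvd m n}"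
  interpret cring ?R by (rule cring_poly_ring)
  have absorb: "p * q \<in> ?I" if p: "p \<in> ?I" and q: "q \<in> carrier ?R" for p q
  proof -
    have "p \<in> carrier ?R" using p by blast
    from m_closed[OF this q] have "p * q \<in> carrier ?R" unfolding poly_ring_sel(2) .
    moreover have "\<exists>m\<in>B. mon_dvd m n" if n: "n \<in> Poly_Mapping.keys (p * q)" for n
    proof -
      obtain a b where ab: "a \<in> Poly_Mapping.keys p" "n = a + b" using keys_mult_ex[OF n] by blast
      then obtain m where "m \<in> B" "mon_dvd m a" using p by (simp, blast)
      then have "mon_dvd m n" using ab(2) by (simp add: mon_dvd_def lookup_add trans_le_add1)
      with \<open>m \<in> B\<close> show ?thesis by blast
    qed
    ultimately show ?thesis by blast
  qed
  have "ideal ?I ?R"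
  proof (rule idealI[OF ring_axioms])
    show "subgroup ?I (add_monoid ?R)"
    proof (rule group.subgroupI)
      show "group (add_monoid ?R)" by (rule a_group)
      show "?I \<subseteq> carrier (add_monoid ?R)" by auto
      have "(0 :: ('v \<Rightarrow>\<^sub>0 nat) \<Rightarrow>\<^sub>0 'k) \<in> ?I" by simp
      then show "?I \<noteq> {}" by blast
    next
      fix p assume p: "p \<in> ?I"
      then have "- p \<in> carrier ?R" by (auto simp: keys_uminus_poly)
      moreover have "p \<in> carrier ?R" using p by simp
      ultimately have "\<ominus>\<^bsub>?R\<^esub> p = - p" by (intro minus_equality) auto
      moreover have "- p \<in> ?I" using p by (simp add: keys_uminus_poly)
      ultimately show "inv\<^bsub>add_monoid ?R\<^esub> p \<in> ?I" by (simp add: a_inv_def)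
    next
      fix p q assume pq: "p \<in> ?I" "q \<in> ?I"
      then have "p + q \<in> carrier ?R" using a_closed[of p q] by simp
      moreover have "\<forall>n\<in>Poly_Mapping.keys (p + q). \<exists>m\<in>B. mon_dvd m n"
        using Poly_Mapping.keys_add[of p q] pq by blast
      ultimately have "p + q \<in> ?I" by blast
      then show "p \<otimes>\<^bsub>add_monoid ?R\<^esub> q \<in> ?I" by simp
    qed
    fix p x assume "p \<in> ?I" "x \<in> carrier ?R"
    then show "x \<otimes>\<^bsub>?R\<^esub> p \<in> ?I" "p \<otimes>\<^bsub>?R\<^esub> x \<in> ?I"
      using absorb[of p x] by (simp_all add: mult.commute)
  qed
  moreover have "monomial ` B \<subseteq> ?I"
    using gens by (auto simp: monomial_def mon_dvd_def)
  ultimately have "genideal ?R (monomial ` B) \<subseteq> ?I" by (rule genideal_minimal)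
  with mem show ?thesis by (auto simp: monomial_def)
qed

lemma edge_mon_pair:
  "u \<noteq> v \<Longrightarrow> edge_mon {u, v} = monomial (Poly_Mapping.single u 1 + Poly_Mapping.single v 1)"
  by (simp add: edge_mon_def) (simp only: var_def monomial_def mult_single mult_1_left One_nat_def)

lemma mon_dvd_edges:
  assumes "mon_dvd (Poly_Mapping.single u 1 + Poly_Mapping.single v 1)
                   (Poly_Mapping.single a 1 + Poly_Mapping.single b 1)"
    and "u \<noteq> v" "a \<noteq> b"
  shows "{u, v} = {a, b}"
proof -
  have "Poly_Mapping.lookup (Poly_Mapping.single u 1 + Poly_Mapping.single v (1::nat)) w \<le>
        Poly_Mapping.lookup (Poly_Mapping.single a 1 + Poly_Mapping.single b 1) w" for w
    using assms(1) unfolding mon_dvd_def by blast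
  from this[of u] this[of v] have "u = a \<or> u = b" "v = a \<or> v = b"
    by (simp_all add: lookup_add lookup_single when_def split: if_splits)
  with assms(2,3) show ?thesis by blast
qed

lemma single_pair_eq:
  assumes "{u, v} = {a, b}"
  shows "Poly_Mapping.single u (1::nat) + Poly_Mapping.single v 1 =
         Poly_Mapping.single a 1 + Poly_Mapping.single b 1"
proof -
  have "u = a \<and> v = b \<or> u = b \<and> v = a" using assms by (simp add: doubleton_eq_iff)
  then show ?thesis by (metis add.commute)
qed

theorem graph_of_ideal_edge_ideal:
  fixes G :: "'v ugraph"
  assumes G: "simple_graph G"
  shows "graph_of_ideal (verts G) (edge_ideal G :: (('v \<Rightarrow>\<^sub>0 nat) \<Rightarrow>\<^sub>0 'k::comm_ring_1) set) = G"
proof -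
  let ?R = "poly_ring (verts G) :: (('v \<Rightarrow>\<^sub>0 nat) \<Rightarrow>\<^sub>0 'k) ring"
  let ?s = "\<lambda>u v :: 'v. Poly_Mapping.single u (1::nat) + Poly_Mapping.single v 1"
  let ?I = "edge_ideal G :: (('v \<Rightarrow>\<^sub>0 nat) \<Rightarrow>\<^sub>0 'k) set"
  define B where "B = {?s u v | u v. u \<noteq> v \<and> {u, v} \<in> edges G}"
  interpret cring ?R by (rule cring_poly_ring)
  have pair: "\<exists>u v. u \<noteq> v \<and> e = {u, v}" if "e \<in> edges G" for e
  proof -
    have "card e = 2" using G that by (simp add: simple_graph_def)
    then show ?thesis by (auto simp only: card_2_iff)
  qed
  have "edge_mon ` edges G = (monomial ` B :: (('v \<Rightarrow>\<^sub>0 nat) \<Rightarrow>\<^sub>0 'k) set)"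
  proof (intro equalityI subsetI)
    fix x :: "('v \<Rightarrow>\<^sub>0 nat) \<Rightarrow>\<^sub>0 'k" assume "x \<in> edge_mon ` edges G"
    then obtain e where e: "e \<in> edges G" "x = edge_mon e" by blast
    obtain u v where uv: "u \<noteq> v" "e = {u, v}" using pair[OF e(1)] by blast
    have "x = monomial (?s u v)" unfolding e(2) uv(2) by (rule edge_mon_pair[OF uv(1)])
    moreover have "?s u v \<in> B" using e(1) uv unfolding B_def by blast
    ultimately show "x \<in> monomial ` B" by blast
  next
    fix x :: "('v \<Rightarrow>\<^sub>0 nat) \<Rightarrow>\<^sub>0 'k" assume "x \<in> monomial ` B"
    then obtain u v where uv: "u \<noteq> v" "{u, v} \<in> edges G" "x = monomial (?s u v)"
      unfolding B_def by blast
    have "x = edge_mon {u, v}" unfolding uv(3) by (rule edge_mon_pair[OF uv(1), symmetric])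
    then show "x \<in> edge_mon ` edges G" using uv(2) by blast
  qed
  then have I: "?I = genideal ?R (monomial ` B)" by (simp add: edge_ideal_def)
  have keysB: "\<forall>m\<in>B. Poly_Mapping.keys m \<subseteq> verts G"
  proof
    fix m assume "m \<in> B"
    then obtain u v where "m = ?s u v" "{u, v} \<in> edges G" unfolding B_def by blast
    moreover from this have "{u, v} \<subseteq> verts G" using G unfolding simple_graph_def by blast
    ultimately show "Poly_Mapping.keys m \<subseteq> verts G" by (simp add: keys_add_nat)
  qed
  have "(monomial ` B :: (('v \<Rightarrow>\<^sub>0 nat) \<Rightarrow>\<^sub>0 'k) set) \<subseteq> carrier ?R"
    using keysB by (auto simp: monomial_def)
  then have BI: "monomial m \<in> ?I" if "m \<in> B" for m
    unfolding I by (rule subsetD[OF genideal_self imageI[OF that]])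
  have ID: "\<exists>m\<in>B. mon_dvd m n" if "monomial n \<in> ?I" for n
    using mon_in_genidealD[OF keysB that[unfolded I]] .
  have minB: "m = n" if mn: "m \<in> B" "n \<in> B" "mon_dvd m n" for m n
  proof -
    obtain u v where m: "m = ?s u v" "u \<noteq> v" using mn(1) unfolding B_def by blast
    obtain a b where n: "n = ?s a b" "a \<noteq> b" using mn(2) unfolding B_def by blast
    have "{u, v} = {a, b}"
      using mon_dvd_edges[OF mn(3)[unfolded m(1) n(1)] m(2) n(2)] .
    then show ?thesis unfolding m(1) n(1) by (rule single_pair_eq)
  qed
  have "min_gens ?I = B"
  proof (intro equalityI subsetI)
    fix n assume n: "n \<in> min_gens ?I"
    then obtain m where "m \<in> B" "mon_dvd m n" using ID by (auto simp: min_gens_def)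
    then show "n \<in> B" using n BI by (auto simp: min_gens_def)
  next
    fix n assume n: "n \<in> B"
    have "m = n" if m: "monomial m \<in> ?I" "mon_dvd m n" for m
    proof -
      obtain l where l: "l \<in> B" "mon_dvd l m" using ID[OF m(1)] by blast
      then have "mon_dvd l n" using m(2) unfolding mon_dvd_def by (meson le_trans)
      then have "l = n" using minB l n by blast
      then show ?thesis using l m(2)
        by (intro poly_mapping_eqI) (auto simp: mon_dvd_def intro: antisym)
    qed
    then show "n \<in> min_gens ?I" using BI[OF n] by (auto simp: min_gens_def)
  qed
  moreover have "?s u v \<in> B \<longleftrightarrow> {u, v} \<in> edges G" if "u \<noteq> v" for u v
  proof
    assume "?s u v \<in> B"
    then obtain a b where ab: "?s u v = ?s a b" "a \<noteq> b" "{a, b} \<in> edges G"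
      unfolding B_def by blast
    then have "mon_dvd (?s u v) (?s a b)" by (simp add: mon_dvd_def)
    then have "{u, v} = {a, b}" by (rule mon_dvd_edges[OF _ that ab(2)])
    then show "{u, v} \<in> edges G" using ab by simp
  next
    assume "{u, v} \<in> edges G"
    with that show "?s u v \<in> B" unfolding B_def by blast
  qed
  then have "u \<noteq> v \<and> ?s u v \<in> B \<longleftrightarrow> u \<noteq> v \<and> {u, v} \<in> edges G" for u v
    by blast
  ultimately have "edges (graph_of_ideal (verts G) ?I) = {{u, v} | u v. u \<noteq> v \<and> {u, v} \<in> edges G}"
    unfolding graph_of_ideal_def by (simp only: ugraph.simps)
  also have "\<dots> = edges G" using pair by blast
  finally have "edges (graph_of_ideal (verts G) ?I) = edges G" .
  then show ?thesis by (simp add: graph_of_ideal_def)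
qed

end

theory Submission
  imports Defs "HOL-Library.Multiset"
begin

text \<open>Write \<open>A\<close> for the multiset of the edges \<open>e\<^sub>1, \<dots>, e\<^sub>s\<close>. Only monomials of degree two in the
  colon ideal \<open>J\<close> matter. Every element of the power \<open>I(G)\<^bsup>s+1\<^esup>\<close> has all its monomials divisible
  by a product of \<open>s + 1\<close> edges, so no monomial of \<open>J\<close> has degree below two, and \<open>x\<^sub>u x\<^sub>v\<close> lies in
  \<open>J\<close> iff \<open>x\<^sub>u x\<^sub>v e\<^sub>1 \<cdots> e\<^sub>s\<close> is exactly a product of \<open>s + 1\<close> edges. Cancelling one edge at a time
  turns such a factorization into a walk from \<open>u\<close> to \<open>v\<close> that alternates between edges of \<open>G\<close>
  and members of \<open>A\<close>; conversely such a walk gives a factorization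
  (\<open>pair_in_colon_iff\<close>). One then says that \<open>u\<close> and \<open>v\<close> are even-connected, where \<open>u = v\<close> is
  possible. Polarization turns these pairs into the edges of \<open>G'\<close>: a pair \<open>u \<noteq> v\<close> into
  itself, and a square into the original vertex joined to a new one. Since every edge of \<open>G'\<close> meets
  the original vertices, and disjoint edges meet them in disjoint sets, an induced matching of
  \<open>G'\<close> becomes a matching of the same size by even-connected pairs or loops between which there is
  no even-connection.

  The heart of the proof is to replace the members of this matching, one at a time, by edges of
  \<open>G\<close>. If \<open>u\<close> and \<open>v\<close> are even-connected by a walk whose first edge is \<open>{u, p}\<close>, then every vertex
  \<open>w\<close> that is even-connected to \<open>p\<close> is also even-connected to \<open>u\<close> or to \<open>v\<close>
  (\<open>even_connected_exchange\<close>): follow the walk from \<open>w\<close> until it first uses an edge of \<open>A\<close> that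
  the walk from \<open>u\<close> to \<open>v\<close> uses as well, and continue along the latter, forwards or backwards
  according to the endpoint at which it was met. Hence \<open>{u, p}\<close> is
  as far from the rest of the matching as \<open>{u, v}\<close> was, and may take its place. After all
  replacements there remains a matching by edges of \<open>G\<close>; it is induced in \<open>G\<close> because
  adjacent vertices are even-connected.\<close>

section \<open>Degrees of monomials\<close>

definition total_degree :: "('v \<Rightarrow>\<^sub>0 nat) \<Rightarrow> nat" where
  "total_degree m = (\<Sum>v\<in>Poly_Mapping.keys m. Poly_Mapping.lookup m v)"

lemma total_degree_superset:
  "finite A \<Longrightarrow> Poly_Mapping.keys m \<subseteq> A \<Longrightarrow> total_degree m = (\<Sum>v\<in>A. Poly_Mapping.lookup m v)"
  unfolding total_degree_def by (rule sum.mono_neutral_left) (auto simp: in_keys_iff)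

lemma total_degree_add: "total_degree (m + n) = total_degree m + total_degree n"
proof -
  let ?A = "Poly_Mapping.keys m \<union> Poly_Mapping.keys n"
  have "total_degree (m + n) = (\<Sum>v\<in>?A. Poly_Mapping.lookup (m + n) v)"
    by (rule total_degree_superset) (simp_all add: keys_add_nat)
  then show ?thesis
    by (simp add: lookup_add sum.distrib total_degree_superset[of ?A m] total_degree_superset[of ?A n])
qed

lemma total_degree_single [simp]: "total_degree (Poly_Mapping.single v n) = n"
  by (simp add: total_degree_def)

lemma total_degree_zero_iff [simp]: "total_degree m = 0 \<longleftrightarrow> m = 0"
  by (auto simp: total_degree_def in_keys_iff intro!: poly_mapping_eqI)

lemma total_degree_sum: "finite A \<Longrightarrow> total_degree (\<Sum>x\<in>A. f x) = (\<Sum>x\<in>A. total_degree (f x))"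
  by (induction A rule: finite_induct) (simp_all add: total_degree_add)

lemma mon_dvd_add: "mon_dvd m n \<Longrightarrow> \<exists>c. n = m + c"
  by (rule exI[of _ "n - m"], rule poly_mapping_eqI)
     (simp add: mon_dvd_def lookup_add lookup_minus)

lemma mon_dvd_degree: "mon_dvd m n \<Longrightarrow> total_degree m \<le> total_degree n"
  by (auto dest!: mon_dvd_add simp: total_degree_add)

lemma mon_dvd_degree_eq: "mon_dvd m n \<Longrightarrow> total_degree n \<le> total_degree m \<Longrightarrow> m = n"
  by (auto dest!: mon_dvd_add simp: total_degree_add)

abbreviation pair_mon :: "'v \<Rightarrow> 'v \<Rightarrow> ('v \<Rightarrow>\<^sub>0 nat)" where
  "pair_mon u v \<equiv> Poly_Mapping.single u 1 + Poly_Mapping.single v 1"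

lemma positive_degree_split:
  assumes "0 < total_degree m"
  shows "\<exists>v n. m = Poly_Mapping.single v 1 + n"
proof -
  have "Poly_Mapping.keys m \<noteq> {}" using assms unfolding total_degree_def by (metis sum.empty less_irrefl)
  then obtain v where "v \<in> Poly_Mapping.keys m" by blast
  then have "mon_dvd (Poly_Mapping.single v 1) m"
    by (simp add: mon_dvd_def lookup_single when_def in_keys_iff)
  then show ?thesis using mon_dvd_add by blast
qed

lemma degree_two_pair_mon:
  assumes "total_degree m = 2"
  shows "\<exists>u v. m = pair_mon u v"
proof -
  obtain u n where n: "m = Poly_Mapping.single u 1 + n"
    using positive_degree_split[of m] assms by auto
  then have "total_degree n = 1" using assms by (simp add: total_degree_add)
  then obtain v n' where n': "n = Poly_Mapping.single v 1 + n'" "total_degree n = 1"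
    using positive_degree_split[of n] by auto
  then have "n' = 0" by (simp add: total_degree_add)
  then show ?thesis using n n' by auto
qed


section \<open>Even-connected vertices\<close>

text \<open>The exponent vector of the monomial \<open>edge_mon e\<close>. Factorizations into edges are written as
  sums of exponent vectors, where cancellation is available.\<close>

definition edge_exp :: "'v set \<Rightarrow> ('v \<Rightarrow>\<^sub>0 nat)" where
  "edge_exp e = (\<Sum>v\<in>e. Poly_Mapping.single v 1)"

lemma edge_exp_pair: "u \<noteq> v \<Longrightarrow> edge_exp {u, v} = pair_mon u v"
  by (simp add: edge_exp_def)

text \<open>A walk from \<open>u\<close> to \<open>v\<close> that alternates between edges of \<open>E\<close> and the listed oriented
  pairs, beginning and ending with an edge of \<open>E\<close>.\<close>

fun walk :: "'v set set \<Rightarrow> 'v \<Rightarrow> ('v \<times> 'v) list \<Rightarrow> 'v \<Rightarrow> bool" where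
  "walk E u [] v \<longleftrightarrow> {u, v} \<in> E"
| "walk E u ((a, b) # L) v \<longleftrightarrow> {u, a} \<in> E \<and> walk E b L v"

text \<open>The pairs of a walk are oriented, but it is the multiset of unoriented edges that has to be
  contained in the given multiset \<open>A\<close>: every occurrence in \<open>A\<close> may be used once, in either direction.\<close>

definition steps :: "('v \<times> 'v) list \<Rightarrow> 'v set multiset" where
  "steps L = mset (map (\<lambda>(a, b). {a, b}) L)"

lemma steps_simps [simp]:
  "steps [] = {#}" "steps ((a, b) # L) = add_mset {a, b} (steps L)"
  "steps (K @ L) = steps K + steps L"
  by (simp_all add: steps_def)

lemma steps_reverse [simp]: "steps (rev (map prod.swap L)) = steps L"
  by (simp add: steps_def rev_map[symmetric] comp_def case_prod_unfold insert_commute)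

lemma set_steps: "set_mset (steps L) = (\<lambda>(a, b). {a, b}) ` set L"
  by (simp add: steps_def)

lemma walk_append: "walk E u (K @ (a, b) # L) v \<longleftrightarrow> walk E u K a \<and> walk E b L v"
  by (induction K arbitrary: u) auto

lemma walk_reverse: "walk E u L v \<Longrightarrow> walk E v (rev (map prod.swap L)) u"
  by (induction L arbitrary: u) (auto simp: insert_commute walk_append)

definition even_connected :: "'v set set \<Rightarrow> 'v set multiset \<Rightarrow> 'v \<Rightarrow> 'v \<Rightarrow> bool" where
  "even_connected E A u v \<longleftrightarrow> (\<exists>L. walk E u L v \<and> steps L \<subseteq># A)"

lemma even_connected_sym: "even_connected E A u v \<Longrightarrow> even_connected E A v u"
  unfolding even_connected_def using walk_reverse steps_reverse by metis

lemma even_connected_edge: "{u, v} \<in> E \<Longrightarrow> even_connected E A u v"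
  unfolding even_connected_def by (rule exI[of _ "[]"]) simp

text \<open>Multiply \<open>x\<^sub>u x\<^sub>v\<close> by the listed pairs of the walk: each position on the walk then
  contributes its vertex once, and the same positions are also paired off by the edges of \<open>E\<close> on
  the walk, which are one more in number than the listed pairs.\<close>

lemma walk_factorization:
  assumes two: "\<And>e. e \<in> E \<Longrightarrow> card e = 2"
    and "walk E u L v" "set_mset (steps L) \<subseteq> E"
  shows "\<exists>F. set_mset F \<subseteq> E \<and> size F = Suc (size (steps L)) \<and>
           pair_mon u v + (\<Sum>e\<in>#steps L. edge_exp e) = (\<Sum>f\<in>#F. edge_exp f)"
  using assms(2,3)
proof (induction L arbitrary: u)
  case Nil
  then have "u \<noteq> v" using two[of "{u, v}"] by auto
  with Nil show ?case by (intro exI[of _ "{#{u, v}#}"]) (simp add: edge_exp_pair)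
next
  case (Cons p L)
  obtain a b where p: "p = (a, b)" by (cases p)
  have E: "{u, a} \<in> E" "{a, b} \<in> E" "walk E b L v" "set_mset (steps L) \<subseteq> E"
    using Cons.prems p by auto
  have ne: "u \<noteq> a" "a \<noteq> b" using two[OF E(1)] two[OF E(2)] by auto
  obtain F where F: "set_mset F \<subseteq> E" "size F = Suc (size (steps L))"
    "pair_mon b v + (\<Sum>e\<in>#steps L. edge_exp e) = (\<Sum>f\<in>#F. edge_exp f)"
    using Cons.IH[OF E(3,4)] by blast
  have "pair_mon u v + (pair_mon a b + (\<Sum>e\<in>#steps L. edge_exp e))
      = pair_mon u a + (\<Sum>f\<in>#F. edge_exp f)"
    unfolding F(3)[symmetric] by (simp only: ac_simps)
  then show ?case using F(1,2) E(1) ne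
    by (intro exI[of _ "add_mset {u, a} F"]) (simp add: p edge_exp_pair)
qed

text \<open>Members of \<open>A\<close> that the walk does not use appear unchanged in the factorization.\<close>

lemma even_connected_factorization:
  assumes two: "\<And>e. e \<in> E \<Longrightarrow> card e = 2"
    and A: "set_mset A \<subseteq> E" and uv: "even_connected E A u v"
  shows "\<exists>F. set_mset F \<subseteq> E \<and> size F = Suc (size A) \<and>
           pair_mon u v + (\<Sum>e\<in>#A. edge_exp e) = (\<Sum>f\<in>#F. edge_exp f)"
proof -
  obtain L where L: "walk E u L v" "steps L \<subseteq># A" using uv by (auto simp: even_connected_def)
  then obtain B where B: "A = steps L + B" using subset_mset.le_iff_add by blast
  then have "set_mset (steps L) \<subseteq> E" using A by simp
  then obtain F where F: "set_mset F \<subseteq> E" "size F = Suc (size (steps L))"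
    "pair_mon u v + (\<Sum>e\<in>#steps L. edge_exp e) = (\<Sum>f\<in>#F. edge_exp f)"
    using walk_factorization[OF two L(1)] by blast
  have "pair_mon u v + (\<Sum>e\<in>#A. edge_exp e) = (\<Sum>f\<in>#F + B. edge_exp f)"
    using F(3) by (simp add: B add.assoc[symmetric])
  then show ?thesis using F A B by (intro exI[of _ "F + B"]) simp
qed

lemma keys_edge_sum:
  assumes "\<And>e. e \<in># F \<Longrightarrow> finite e"
  shows "Poly_Mapping.keys (\<Sum>f\<in>#F. edge_exp f) = \<Union> (set_mset F)"
proof -
  have 1: "Poly_Mapping.keys (edge_exp e) = e" if "finite e" for e :: "'a set"
    unfolding edge_exp_def using that
    by (induction e rule: finite_induct) (simp_all add: keys_add_nat)
  show ?thesis using assms by (induction F) (simp_all add: keys_add_nat 1 Un_commute)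
qed

text \<open>Induction on the size of \<open>A\<close>. Some factor \<open>{u, p}\<close> on the right contains \<open>u\<close>. If \<open>p \<noteq> v\<close>,
  then \<open>p\<close> must come from some \<open>{p, q}\<close> in \<open>A\<close>; cancelling both edges leaves a factorization of
  the same form for \<open>q\<close> and \<open>v\<close>, whose walk is to be prolonged by \<open>u\<close> and \<open>(p, q)\<close>.\<close>

lemma factorization_even_connected:
  assumes two: "\<And>e. e \<in> E \<Longrightarrow> card e = 2"
    and "set_mset A \<subseteq> E" "set_mset F \<subseteq> E"
    and "pair_mon u v + (\<Sum>e\<in>#A. edge_exp e) = (\<Sum>f\<in>#F. edge_exp f)"
  shows "even_connected E A u v"
  using assms(2-4)
proof (induction "size A" arbitrary: A F u rule: less_induct)
  case less
  have fin: "finite e" if "e \<in> E" for e using two[OF that] by (auto intro: card_ge_0_finite)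
  have other: "\<exists>q. e = {p, q} \<and> p \<noteq> q" if "e \<in> E" "p \<in> e" for e p
    using two[OF that(1)] that(2) unfolding card_2_iff by (metis insert_commute insertE singletonD)
  have keysF: "Poly_Mapping.keys (\<Sum>f\<in>#F. edge_exp f) = \<Union> (set_mset F)"
    and keysA: "Poly_Mapping.keys (\<Sum>f\<in>#A. edge_exp f) = \<Union> (set_mset A)"
    using less.prems(1,2) fin by (simp_all add: keys_edge_sum subset_iff)
  have "u \<in> Poly_Mapping.keys (\<Sum>f\<in>#F. edge_exp f)"
    unfolding less.prems(3)[symmetric] by (simp add: keys_add_nat)
  then obtain f where f: "f \<in># F" "u \<in> f" unfolding keysF by blast
  then obtain p where p: "f = {u, p}" "u \<noteq> p" using other less.prems(2) by blast
  obtain F' where F': "F = add_mset f F'" using f(1) by (rule mset_add)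
  have up: "{u, p} \<in> E" using f(1) less.prems(2) p(1) by blast
  have "Poly_Mapping.single u 1 + (Poly_Mapping.single v 1 + (\<Sum>e\<in>#A. edge_exp e))
      = Poly_Mapping.single u 1 + (Poly_Mapping.single p 1 + (\<Sum>f\<in>#F'. edge_exp f))"
    using less.prems(3) by (simp add: F' p edge_exp_pair add.assoc)
  then have rest: "Poly_Mapping.single v 1 + (\<Sum>e\<in>#A. edge_exp e)
      = Poly_Mapping.single p 1 + (\<Sum>f\<in>#F'. edge_exp f)"
    by (rule add_left_imp_eq)
  show ?case
  proof (cases "p = v")
    case True
    then show ?thesis using up even_connected_edge by simp
  next
    case False
    have "p \<in> Poly_Mapping.keys (Poly_Mapping.single v 1 + (\<Sum>e\<in>#A. edge_exp e))"
      unfolding rest by (simp add: keys_add_nat)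
    then obtain e where e: "e \<in># A" "p \<in> e" using False by (auto simp: keys_add_nat keysA)
    then obtain q where q: "e = {p, q}" "p \<noteq> q" using other less.prems(1) by blast
    obtain A' where A': "A = add_mset e A'" using e(1) by (rule mset_add)
    have "Poly_Mapping.single p 1 + (pair_mon q v + (\<Sum>e\<in>#A'. edge_exp e))
        = Poly_Mapping.single v 1 + (\<Sum>e\<in>#A. edge_exp e)"
      by (simp add: A' q edge_exp_pair ac_simps)
    also note rest
    finally have "pair_mon q v + (\<Sum>e\<in>#A'. edge_exp e) = (\<Sum>f\<in>#F'. edge_exp f)"
      by (rule add_left_imp_eq)
    then have "even_connected E A' q v"
      using less.hyps[of A' F' q] less.prems(1,2) by (simp add: A' F')
    then obtain L where L: "walk E q L v" "steps L \<subseteq># A'" unfolding even_connected_def by blast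
    have "walk E u ((p, q) # L) v" using up L(1) by simp
    moreover have "steps ((p, q) # L) \<subseteq># A" using L(2) by (simp add: A' q)
    ultimately show ?thesis unfolding even_connected_def by blast
  qed
qed

text \<open>The vertex \<open>p\<close> is the second one on a walk \<open>L\<close> from \<open>u\<close> to \<open>v\<close>. A walk \<open>K\<close> from \<open>w\<close> to \<open>p\<close>
  cannot simply be joined to the part of \<open>L\<close> after \<open>p\<close>, since together they may use some member
  of \<open>A\<close> too often. Cutting \<open>K\<close> before the first step that it shares with \<open>L\<close> removes this
  obstacle: the shared step is then used only as a part of \<open>L\<close>, and the direction in which
  \<open>L\<close> has to be followed from there decides between \<open>u\<close> and \<open>v\<close>.\<close>

lemma even_connected_exchange:
  assumes "even_connected E A u v"
  shows "\<exists>p. {u, p} \<in> E \<and>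
           (\<forall>w. even_connected E A w p \<longrightarrow> even_connected E A w u \<or> even_connected E A w v)"
proof -
  obtain L where L: "walk E u L v" "steps L \<subseteq># A" using assms by (auto simp: even_connected_def)
  show ?thesis
  proof (cases L)
    case Nil
    then show ?thesis using L by auto
  next
    case (Cons pb L0)
    obtain p b where pb: "pb = (p, b)" by (cases pb)
    \<comment> \<open>An initial part \<open>K\<close> of the walk from \<open>w\<close> that shares no step with \<open>L\<close> reaches an endpoint of
      a step of \<open>L\<close>.\<close>
    have key: "even_connected E A w u \<or> even_connected E A w v"
      if wK: "walk E w K c" "steps K \<subseteq># A" "set_mset (steps K) \<inter> set_mset (steps L) = {}"
        and L12: "L = L1 @ (a, b) # L2" and cab: "c = a \<or> c = b" for w K c L1 a b L2
    proof -
      have sum: "steps K + steps L \<subseteq># A"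
      proof (rule mset_subset_eqI)
        fix x
        have "count (steps K) x = 0 \<or> count (steps L) x = 0"
          using wK(3) by (auto simp: count_eq_zero_iff)
        moreover have "count (steps K) x \<le> count A x" "count (steps L) x \<le> count A x"
          using wK(2) L(2) by (simp_all add: mset_subset_eq_count)
        ultimately show "count (steps K + steps L) x \<le> count A x" by auto
      qed
      show ?thesis
        using cab
      proof
        assume "c = a"
        then have "walk E w (K @ (a, b) # L2) v" using wK(1) L(1) L12 by (simp add: walk_append)
        moreover have "steps (K @ (a, b) # L2) \<subseteq># steps K + steps L" by (simp add: L12)
        ultimately show ?thesis using sum subset_mset.order_trans unfolding even_connected_def by blast
      next
        let ?R = "rev (map prod.swap L1)"
        assume "c = b"
        then have "walk E w (K @ (b, a) # ?R) u"
          using wK(1) L(1) L12 walk_reverse[of E u L1 a] by (simp add: walk_append)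
        moreover have "steps (K @ (b, a) # ?R) \<subseteq># steps K + steps L"
          by (simp add: L12 insert_commute)
        ultimately show ?thesis using sum subset_mset.order_trans unfolding even_connected_def by blast
      qed
    qed
    have "even_connected E A w u \<or> even_connected E A w v" if w: "even_connected E A w p" for w
    proof -
      obtain K where K: "walk E w K p" "steps K \<subseteq># A" using w by (auto simp: even_connected_def)
      show ?thesis
      proof (cases "\<exists>(a, b)\<in>set K. {a, b} \<in># steps L")
        case False
        then have "set_mset (steps K) \<inter> set_mset (steps L) = {}" unfolding set_steps[of K] by auto
        \<comment> \<open>Without a shared step, all of \<open>K\<close> is kept and it meets \<open>L\<close> at its first pair.\<close>
        from key[OF K this, of "[]" p b L0] show ?thesis by (simp add: Cons pb)
      next
        case True
        then have "\<exists>x\<in>set K. (\<lambda>(a, b). {a, b} \<in># steps L) x" by blast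
        from split_list_first_prop[OF this] obtain K1 x K2 where
          K12: "K = K1 @ x # K2" "(\<lambda>(a, b). {a, b} \<in># steps L) x"
            "\<forall>y\<in>set K1. \<not> (\<lambda>(a, b). {a, b} \<in># steps L) y" by blast
        obtain c d where x: "x = (c, d)" by (cases x)
        then have "{c, d} \<in># steps L" using K12(2) by simp
        then obtain a b where ab: "(a, b) \<in> set L" "{c, d} = {a, b}" by (auto simp: steps_def)
        obtain L1 L2 where L12: "L = L1 @ (a, b) # L2" using split_list[OF ab(1)] by blast
        have "walk E w K1 c" using K(1) by (simp add: K12(1) x walk_append)
        moreover have "steps K1 \<subseteq># A"
          using K(2) unfolding K12(1) by (simp, meson mset_subset_eq_add_left subset_mset.order_trans)
        moreover have "set_mset (steps K1) \<inter> set_mset (steps L) = {}"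
          using K12(3) unfolding set_steps[of K1] by auto
        moreover have "c = a \<or> c = b" using ab(2) by blast
        ultimately show ?thesis using L12 by (intro key)
      qed
    qed
    moreover have "{u, p} \<in> E" using L(1) Cons pb by simp
    ultimately show ?thesis by blast
  qed
qed

section \<open>Replacing the members of a matching by edges\<close>

text \<open>The relation \<open>R\<close> need not be irreflexive, and a loop at \<open>u\<close> is the member \<open>{u}\<close> of the
  matching: this is how the squares among the generators of the colon ideal take part.\<close>

definition rel_matching :: "('v \<Rightarrow> 'v \<Rightarrow> bool) \<Rightarrow> 'v set set \<Rightarrow> bool" where
  "rel_matching R M \<longleftrightarrow>
     (\<forall>e\<in>M. \<exists>u v. e = {u, v} \<and> R u v) \<and>
     (\<forall>e\<in>M. \<forall>f\<in>M. e \<noteq> f \<longrightarrow> e \<inter> f = {} \<and> (\<forall>x\<in>e. \<forall>y\<in>f. \<not> R x y))"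

lemma rel_matchingD:
  assumes "rel_matching R M"
  shows "e \<in> M \<Longrightarrow> \<exists>u v. e = {u, v} \<and> R u v"
    and "e \<in> M \<Longrightarrow> f \<in> M \<Longrightarrow> e \<noteq> f \<Longrightarrow> e \<inter> f = {}"
    and "e \<in> M \<Longrightarrow> f \<in> M \<Longrightarrow> e \<noteq> f \<Longrightarrow> x \<in> e \<Longrightarrow> y \<in> f \<Longrightarrow> \<not> R x y"
  using assms unfolding rel_matching_def by simp_all

text \<open>The set \<open>K\<close> collects the edges obtained so far and \<open>N\<close> the members still to be replaced.
  Everything outside \<open>{u, v}\<close> that avoids \<open>u\<close> and \<open>v\<close> with respect to \<open>R\<close> also avoids the vertex
  \<open>p\<close> given by the exchange property. The property is used for \<open>R\<close> itself after
  every replacement, so the matching has to remain one for \<open>R\<close>, not only for \<open>E\<close>.\<close>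

lemma rel_matching_to_edges:
  assumes sym: "\<And>u v. R u v \<Longrightarrow> R v u"
    and sub: "\<And>u v. {u, v} \<in> E \<Longrightarrow> R u v"
    and exch: "\<And>u v. R u v \<Longrightarrow> \<exists>p. {u, p} \<in> E \<and> (\<forall>w. R w p \<longrightarrow> R w u \<or> R w v)"
    and "finite N" "K \<subseteq> E" "finite K" "N \<inter> K = {}" "rel_matching R (N \<union> K)"
  shows "\<exists>M\<subseteq>E. rel_matching R M \<and> card M = card N + card K"
  using assms(4-)
proof (induction N arbitrary: K rule: finite_induct)
  case empty
  then show ?case by auto
next
  case (insert f N)
  let ?M = "insert f N \<union> K"
  note M = rel_matchingD[OF insert.prems(4)]
  obtain u v where uv: "f = {u, v}" "R u v" using M(1)[of f] by auto
  obtain p where p: "{u, p} \<in> E" "\<And>w. R w p \<Longrightarrow> R w u \<or> R w v"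
    using exch[OF uv(2)] by meson
  have Rup: "R u p" using sub[OF p(1)] .
  have far: "{u, p} \<inter> g = {}" "x \<in> {u, p} \<Longrightarrow> y \<in> g \<Longrightarrow> \<not> R x y \<and> \<not> R y x"
    if g: "g \<in> N \<union> K" for g x y
  proof -
    have gf: "g \<in> ?M" "f \<in> ?M" "g \<noteq> f" using g insert.hyps(2) insert.prems(3) by auto
    have u: "u \<notin> g" using M(2)[OF gf] uv(1) by auto
    have uvg: "\<not> R y u" "\<not> R y v" if "y \<in> g" for y
      using M(3)[OF gf that] uv(1) by simp_all
    \<comment> \<open>Since \<open>p\<close> is related to \<open>u\<close>, it cannot lie on another member of the matching.\<close>
    have "p \<notin> g" using uvg(1) sym[OF Rup] by meson
    then show "{u, p} \<inter> g = {}" using u by simp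
    assume "x \<in> {u, p}" "y \<in> g"
    then have "\<not> R y x" using p(2)[of y] uvg[of y] by auto
    then show "\<not> R x y \<and> \<not> R y x" using sym[of x y] by meson
  qed
  have notin: "{u, p} \<notin> N \<union> K" using far(1)[of "{u, p}"] by auto
  have "rel_matching R (N \<union> insert {u, p} K)"
    unfolding rel_matching_def
  proof (intro conjI ballI impI)
    fix g assume g: "g \<in> N \<union> insert {u, p} K"
    show "\<exists>u v. g = {u, v} \<and> R u v"
    proof (cases "g = {u, p}")
      case False
      then show ?thesis using g by (intro M(1)) auto
    qed (use Rup in auto)
  next
    fix g h assume gh: "g \<in> N \<union> insert {u, p} K" "h \<in> N \<union> insert {u, p} K" "g \<noteq> h"
    then consider "g = {u, p}" "h \<in> N \<union> K" | "h = {u, p}" "g \<in> N \<union> K" | "g \<in> ?M" "h \<in> ?M"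
      by auto
    note cases = this
    show "g \<inter> h = {}" using cases far(1)[of g] far(1)[of h] M(2)[OF _ _ gh(3)] by cases auto
    fix x y assume "x \<in> g" "y \<in> h"
    then show "\<not> R x y" using cases far(2)[of h x y] far(2)[of g y x] M(3)[OF _ _ gh(3)]
      by cases auto
  qed
  moreover have "insert {u, p} K \<subseteq> E" "finite (insert {u, p} K)" "N \<inter> insert {u, p} K = {}"
    using insert.prems p(1) notin by simp_all
  ultimately have "\<exists>M\<subseteq>E. rel_matching R M \<and> card M = card N + card (insert {u, p} K)"
    by (intro insert.IH)
  moreover have "card N + card (insert {u, p} K) = card (insert f N) + card K"
    using insert.hyps insert.prems(2) notin by simp
  ultimately show ?case by (simp only:)
qed


section \<open>Monomials in powers of an edge ideal and in their colon ideals\<close>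

definition supported_polys ::
    "'v set \<Rightarrow> ('v \<Rightarrow>\<^sub>0 nat) set \<Rightarrow> (('v \<Rightarrow>\<^sub>0 nat) \<Rightarrow>\<^sub>0 'k::comm_ring_1) set" where
  "supported_polys X U = {p \<in> carrier (poly_ring X). Poly_Mapping.keys p \<subseteq> U}"

lemma ideal_supported_polys:
  assumes up: "\<And>m n. m \<in> U \<Longrightarrow> m + n \<in> U"
  shows "ideal (supported_polys X U :: (('v \<Rightarrow>\<^sub>0 nat) \<Rightarrow>\<^sub>0 'k::comm_ring_1) set) (poly_ring X)"
proof -
  let ?R = "poly_ring X :: (('v \<Rightarrow>\<^sub>0 nat) \<Rightarrow>\<^sub>0 'k) ring"
  interpret cring ?R by (rule cring_poly_ring)
  have mult: "p * q \<in> supported_polys X U"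
    if "p \<in> supported_polys X U" "q \<in> carrier ?R" for p q :: "('v \<Rightarrow>\<^sub>0 nat) \<Rightarrow>\<^sub>0 'k"
  proof -
    have "p * q \<in> carrier ?R"
      using m_closed[of p q] that unfolding supported_polys_def poly_ring_sel(2) by blast
    moreover have "Poly_Mapping.keys (p * q) \<subseteq> U"
      using that(1) up by (auto simp: supported_polys_def dest!: keys_mult_ex)
    ultimately show ?thesis by (simp add: supported_polys_def)
  qed
  show ?thesis
  proof (rule idealI[OF ring_axioms])
    show "subgroup (supported_polys X U) (add_monoid ?R)"
    proof (rule group.subgroupI[OF a_group])
      show "supported_polys X U \<subseteq> carrier (add_monoid ?R)" by (auto simp: supported_polys_def)
      have "0 \<in> supported_polys X U" by (simp add: supported_polys_def)
      then show "supported_polys X U \<noteq> {}" by blast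
    next
      fix p :: "('v \<Rightarrow>\<^sub>0 nat) \<Rightarrow>\<^sub>0 'k" assume p: "p \<in> supported_polys X U"
      then have "\<ominus>\<^bsub>?R\<^esub> p = - p"
        by (intro minus_equality) (auto simp: supported_polys_def keys_uminus_poly)
      then show "inv\<^bsub>add_monoid ?R\<^esub> p \<in> supported_polys X U"
        using p by (simp add: a_inv_def supported_polys_def keys_uminus_poly)
    next
      fix p q :: "('v \<Rightarrow>\<^sub>0 nat) \<Rightarrow>\<^sub>0 'k" assume pq: "p \<in> supported_polys X U" "q \<in> supported_polys X U"
      then have "p + q \<in> carrier ?R" using a_closed[of p q] by (simp add: supported_polys_def)
      moreover have "Poly_Mapping.keys (p + q) \<subseteq> U"
        using pq Poly_Mapping.keys_add[of p q] by (auto simp: supported_polys_def)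
      ultimately show "p \<otimes>\<^bsub>add_monoid ?R\<^esub> q \<in> supported_polys X U"
        by (simp add: supported_polys_def)
    qed
  qed (use mult in \<open>simp_all add: mult.commute\<close>)
qed

text \<open>An upper bound for the exponent vectors that occur in elements of the \<open>k\<close>-th power of the
  edge ideal.\<close>

definition edge_multiples :: "'v set set \<Rightarrow> nat \<Rightarrow> ('v \<Rightarrow>\<^sub>0 nat) set" where
  "edge_multiples E k =
     {(\<Sum>f\<in>#F. edge_exp f) + c | F c. set_mset F \<subseteq> E \<and> size F = k}"

lemma edge_multiples_mult:
  assumes "m \<in> edge_multiples E k" "n \<in> edge_multiples E l"
  shows "m + n \<in> edge_multiples E (k + l)"
proof -
  obtain F c F' c' where "m = (\<Sum>f\<in>#F. edge_exp f) + c" "n = (\<Sum>f\<in>#F'. edge_exp f) + c'"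
    and F: "set_mset F \<subseteq> E" "size F = k" "set_mset F' \<subseteq> E" "size F' = l"
    using assms unfolding edge_multiples_def by blast
  then have "m + n = (\<Sum>f\<in>#F + F'. edge_exp f) + (c + c')" by (simp add: ac_simps)
  then show ?thesis using F unfolding edge_multiples_def
    by (intro CollectI exI[of _ "F + F'"] exI[of _ "c + c'"]) simp
qed

lemma edge_multiples_zero: "edge_multiples E 0 = UNIV"
  by (auto simp: edge_multiples_def)

lemma edge_multiples_up: "m \<in> edge_multiples E k \<Longrightarrow> m + n \<in> edge_multiples E k"
  using edge_multiples_mult[of m E k n 0] by (simp add: edge_multiples_zero)

lemma ideal_power_simps:
  "ideal_power R I 0 = carrier R" "ideal_power R I (Suc k) = ideal_prod R (ideal_power R I k) I"
  by (simp_all add: ideal_power_def nat_pow_def ideals_set_def)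

lemma monomial_mult: "monomial m * monomial n = monomial (m + n)"
  by (simp add: monomial_def mult_single)

lemma keys_monomial [simp]: "Poly_Mapping.keys (monomial m :: _ \<Rightarrow>\<^sub>0 'k::comm_ring_1) = {m}"
  by (simp add: monomial_def)

context
  fixes G :: "'v ugraph"
  assumes G: "simple_graph G"
begin

lemma card_edge: "e \<in> edges G \<Longrightarrow> card e = 2"
  using G by (simp add: simple_graph_def)

lemma finite_edge: "e \<in> edges G \<Longrightarrow> finite e"
  using card_edge[of e] by (auto intro: card_ge_0_finite)

lemma edge_mon_monomial: "e \<in> edges G \<Longrightarrow> edge_mon e = monomial (edge_exp e)"
  using card_edge[of e] unfolding card_2_iff by (metis edge_mon_pair edge_exp_pair)

lemma total_degree_edge_sum:
  "set_mset F \<subseteq> edges G \<Longrightarrow> total_degree (\<Sum>f\<in>#F. edge_exp f) = 2 * size F"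
proof (induction F)
  case (add f F)
  then have "total_degree (edge_exp f) = 2"
    using card_edge[of f] finite_edge[of f] by (simp add: edge_exp_def total_degree_sum)
  with add show ?case by (simp add: total_degree_add)
qed simp

lemma keys_edge_sum_verts:
  assumes "set_mset F \<subseteq> edges G"
  shows "Poly_Mapping.keys (\<Sum>f\<in>#F. edge_exp f) \<subseteq> verts G"
proof -
  have "Poly_Mapping.keys (\<Sum>f\<in>#F. edge_exp f) = \<Union> (set_mset F)"
    using assms finite_edge by (intro keys_edge_sum) blast
  then show ?thesis using assms G unfolding simple_graph_def by blast
qed

lemma edge_mon_in_carrier: "edge_mon ` edges G \<subseteq> carrier (poly_ring (verts G))"
proof
  fix p :: "('v \<Rightarrow>\<^sub>0 nat) \<Rightarrow>\<^sub>0 'k::comm_ring_1" assume "p \<in> edge_mon ` edges G"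
  then obtain e where e: "e \<in> edges G" "p = monomial (edge_exp e)"
    using edge_mon_monomial by blast
  then show "p \<in> carrier (poly_ring (verts G))"
    using keys_edge_sum_verts[of "{#e#}"] by simp
qed

text \<open>The polynomials all of whose monomials are divisible by a product of \<open>k\<close> edges form an ideal,
  which contains the generators for \<open>k = 1\<close> and is multiplicative in \<open>k\<close>.\<close>

lemma ideal_power_supported:
  "ideal_power (poly_ring (verts G)) (edge_ideal G :: (('v \<Rightarrow>\<^sub>0 nat) \<Rightarrow>\<^sub>0 'k::comm_ring_1) set) k
     \<subseteq> supported_polys (verts G) (edge_multiples (edges G) k)"
proof (induction k)
  case 0
  show ?case by (simp add: ideal_power_simps edge_multiples_zero supported_polys_def)
next
  case (Suc k)
  let ?R = "poly_ring (verts G) :: (('v \<Rightarrow>\<^sub>0 nat) \<Rightarrow>\<^sub>0 'k) ring"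
  let ?S = "\<lambda>k. supported_polys (verts G) (edge_multiples (edges G) k) :: (('v \<Rightarrow>\<^sub>0 nat) \<Rightarrow>\<^sub>0 'k) set"
  interpret cring ?R by (rule cring_poly_ring)
  interpret S: ideal "?S (Suc k)" ?R
    by (intro ideal_supported_polys edge_multiples_up)
  have "edge_exp e \<in> edge_multiples (edges G) 1" if "e \<in> edges G" for e
    unfolding edge_multiples_def using that
    by (intro CollectI exI[of _ "{#e#}"] exI[of _ 0]) simp
  then have "edge_mon ` edges G \<subseteq> ?S 1"
    using edge_mon_in_carrier by (auto simp: supported_polys_def edge_mon_monomial)
  then have I: "edge_ideal G \<subseteq> ?S 1"
    unfolding edge_ideal_def by (intro genideal_minimal ideal_supported_polys edge_multiples_up)
  show ?case
    unfolding ideal_power_simps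
  proof
    fix p assume "p \<in> ideal_prod ?R (ideal_power ?R (edge_ideal G) k) (edge_ideal G)"
    then show "p \<in> ?S (Suc k)"
    proof (induction rule: ideal_prod.induct)
      case (prod p q)
      then have pq: "p \<in> ?S k" "q \<in> ?S 1" using Suc I by auto
      have "p \<otimes>\<^bsub>?R\<^esub> q \<in> carrier ?R"
        using pq unfolding supported_polys_def by (intro m_closed) auto
      moreover have "Poly_Mapping.keys (p * q) \<subseteq> edge_multiples (edges G) (Suc k)"
      proof
        fix m assume "m \<in> Poly_Mapping.keys (p * q)"
        then obtain a b where "a \<in> Poly_Mapping.keys p" "b \<in> Poly_Mapping.keys q" "m = a + b"
          using keys_mult_ex by blast
        then show "m \<in> edge_multiples (edges G) (Suc k)"
          using pq edge_multiples_mult[of a "edges G" k b 1]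
          unfolding supported_polys_def by (auto dest!: subsetD)
      qed
      ultimately show ?case unfolding supported_polys_def poly_ring_sel(2) by blast
    next
      case (sum p q)
      from S.a_closed[OF sum.IH] show ?case .
    qed
  qed
qed

lemma edge_sum_in_ideal_power:
  assumes "set_mset F \<subseteq> edges G"
  shows "(monomial (\<Sum>f\<in>#F. edge_exp f) :: ('v \<Rightarrow>\<^sub>0 nat) \<Rightarrow>\<^sub>0 'k::comm_ring_1)
           \<in> ideal_power (poly_ring (verts G)) (edge_ideal G) (size F)"
  using assms
proof (induction F)
  case empty
  show ?case by (simp add: ideal_power_simps)
next
  case (add f F)
  let ?R = "poly_ring (verts G) :: (('v \<Rightarrow>\<^sub>0 nat) \<Rightarrow>\<^sub>0 'k) ring"
  interpret cring ?R by (rule cring_poly_ring)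
  have "edge_mon f \<in> (edge_ideal G :: (('v \<Rightarrow>\<^sub>0 nat) \<Rightarrow>\<^sub>0 'k) set)"
    unfolding edge_ideal_def using genideal_self[OF edge_mon_in_carrier] add.prems by auto
  then have f: "monomial (edge_exp f) \<in> (edge_ideal G :: (('v \<Rightarrow>\<^sub>0 nat) \<Rightarrow>\<^sub>0 'k) set)"
    using add.prems by (simp add: edge_mon_monomial)
  have "monomial (\<Sum>f\<in>#F. edge_exp f) \<otimes>\<^bsub>?R\<^esub> monomial (edge_exp f)
      \<in> ideal_power ?R (edge_ideal G) (Suc (size F))"
    unfolding ideal_power_simps using add f by (intro ideal_prod.prod) auto
  then show ?case by (simp add: monomial_mult add.commute)
qed

context
  fixes A :: "'v set multiset" and J :: "(('v \<Rightarrow>\<^sub>0 nat) \<Rightarrow>\<^sub>0 'k::comm_ring_1) set"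
  assumes A: "set_mset A \<subseteq> edges G"
    and J: "J = ideal_colon (poly_ring (verts G))
              (ideal_power (poly_ring (verts G)) (edge_ideal G) (Suc (size A)))
              (monomial (\<Sum>e\<in>#A. edge_exp e))"
begin

text \<open>The product with the monomial of \<open>A\<close> is divisible by one more edge than \<open>A\<close> has; as every edge has degree
  two, the cofactor \<open>c\<close> accounts for all of the degree of \<open>m\<close> beyond two. In degree two there is
  no room for a cofactor, and the divisibility becomes an equation.\<close>

lemma monomial_in_colonD:
  assumes "monomial m \<in> J"
  shows "\<exists>F c. set_mset F \<subseteq> edges G \<and> size F = Suc (size A) \<and>
           m + (\<Sum>e\<in>#A. edge_exp e) = (\<Sum>f\<in>#F. edge_exp f) + c \<and>
           total_degree m = 2 + total_degree c"
proof -
  let ?a = "\<Sum>e\<in>#A. edge_exp e"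
  have "(monomial (m + ?a) :: ('v \<Rightarrow>\<^sub>0 nat) \<Rightarrow>\<^sub>0 'k)
      \<in> ideal_power (poly_ring (verts G)) (edge_ideal G) (Suc (size A))"
    using assms unfolding J ideal_colon_def by (simp add: monomial_mult)
  then have "m + ?a \<in> edge_multiples (edges G) (Suc (size A))"
    using ideal_power_supported by (fastforce simp: supported_polys_def)
  then obtain F c where F: "set_mset F \<subseteq> edges G" "size F = Suc (size A)"
    "m + ?a = (\<Sum>f\<in>#F. edge_exp f) + c" unfolding edge_multiples_def by blast
  have "total_degree m + 2 * size A = 2 * size F + total_degree c"
    using arg_cong[OF F(3), of total_degree] A F(1)
    by (simp add: total_degree_add total_degree_edge_sum)
  then show ?thesis using F by auto
qed

lemma colon_degree_ge_two: "monomial m \<in> J \<Longrightarrow> 2 \<le> total_degree m"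
  using monomial_in_colonD by fastforce

lemma pair_in_colon_iff: "monomial (pair_mon u v) \<in> J \<longleftrightarrow> even_connected (edges G) A u v"
proof
  assume "monomial (pair_mon u v) \<in> J"
  from monomial_in_colonD[OF this] obtain F c where F: "set_mset F \<subseteq> edges G"
    "pair_mon u v + (\<Sum>e\<in>#A. edge_exp e) = (\<Sum>f\<in>#F. edge_exp f) + c"
    "total_degree (pair_mon u v) = 2 + total_degree c" by blast
  then have "c = 0" by (simp add: total_degree_add)
  then show "even_connected (edges G) A u v"
    using F(1,2) by (intro factorization_even_connected[OF card_edge A F(1)]) auto
next
  assume "even_connected (edges G) A u v"
  from even_connected_factorization[OF card_edge A this] obtain F where
    F: "set_mset F \<subseteq> edges G" "size F = Suc (size A)"
    "pair_mon u v + (\<Sum>e\<in>#A. edge_exp e) = (\<Sum>f\<in>#F. edge_exp f)" by auto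
  have "Poly_Mapping.keys (pair_mon u v) \<subseteq> verts G"
    using keys_edge_sum_verts[OF F(1)] unfolding F(3)[symmetric] by (simp add: keys_add_nat)
  then show "monomial (pair_mon u v) \<in> J"
    using edge_sum_in_ideal_power[OF F(1)] unfolding F(2) F(3)[symmetric] J ideal_colon_def
    by (simp add: monomial_mult)
qed

end

end


section \<open>The graph of a polarization\<close>

lemma lookup_polarize:
  "Poly_Mapping.lookup (polarize m) (v, j) = (if 1 \<le> j \<and> j \<le> Poly_Mapping.lookup m v then 1 else 0)"
proof -
  have "Poly_Mapping.lookup (polarize m) (v, j) =
      (\<Sum>w\<in>Poly_Mapping.keys m. if w = v then
         (\<Sum>i=1..Poly_Mapping.lookup m w. if i = j then 1 else 0) else 0)"
    unfolding polarize_def lookup_sum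
    by (rule sum.cong) (auto simp: lookup_single when_def intro!: sum.cong)
  also have "\<dots> = (if 1 \<le> j \<and> j \<le> Poly_Mapping.lookup m v then 1 else 0)"
    by (auto simp: sum.delta in_keys_iff)
  finally show ?thesis .
qed

lemma keys_polarize: "Poly_Mapping.keys (polarize m) = {(v, j). 1 \<le> j \<and> j \<le> Poly_Mapping.lookup m v}"
  by (auto simp: in_keys_iff lookup_polarize split: if_splits)

lemma total_degree_polarize: "total_degree (polarize m) = total_degree m"
  unfolding polarize_def by (simp add: total_degree_sum) (simp add: total_degree_def)

lemma polarize_pair: "u \<noteq> v \<Longrightarrow> polarize (pair_mon u v) = pair_mon (u, 1) (v, 1)"
  by (rule poly_mapping_eqI)
     (auto simp: lookup_polarize lookup_add lookup_single when_def split: if_splits)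

text \<open>If no monomial of \<open>I\<close> has degree below two, then all monomials of degree two in \<open>I\<close> are minimal
  generators, and since polarization preserves degrees the same holds for its polarization.
  Minimal generators of higher degree therefore contribute no edge and remove none.\<close>

context
  fixes X :: "'v set" and I :: "(('v \<Rightarrow>\<^sub>0 nat) \<Rightarrow>\<^sub>0 'k::comm_ring_1) set"
  assumes degree_ge_two: "\<And>m. monomial m \<in> I \<Longrightarrow> 2 \<le> total_degree m"
begin

lemma polarization_dvd:
  assumes "monomial n \<in> polarization X I"
  shows "\<exists>m\<in>min_gens I. mon_dvd (polarize m) n"
proof -
  have "\<exists>l\<in>polarize ` min_gens I. mon_dvd l n"
    using assms unfolding polarization_def image_image[symmetric, of monomial polarize]
    by (intro mon_in_genidealD[where X = "polar_vars X I"]) (auto simp: polar_vars_def)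
  then show ?thesis by blast
qed

lemma edge_of_polarizationD:
  assumes "f \<in> edges (graph_of_ideal (polar_vars X I) (polarization X I))"
  shows "\<exists>u v. monomial (pair_mon u v) \<in> I \<and> f = Poly_Mapping.keys (polarize (pair_mon u v))"
proof -
  obtain a b where ab: "f = {a, b}" "a \<noteq> b" "pair_mon a b \<in> min_gens (polarization X I)"
    using assms by (auto simp: graph_of_ideal_def)
  then obtain m where m: "m \<in> min_gens I" "mon_dvd (polarize m) (pair_mon a b)"
    using polarization_dvd[of "pair_mon a b"] by (auto simp: min_gens_def)
  have mI: "monomial m \<in> I" using m(1) by (simp add: min_gens_def)
  have deg: "2 \<le> total_degree (polarize m)"
    using degree_ge_two[OF mI] by (simp add: total_degree_polarize)
  then have eq: "polarize m = pair_mon a b"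
    using m(2) by (intro mon_dvd_degree_eq) (auto simp: total_degree_add)
  then have "total_degree m = 2"
    by (metis total_degree_polarize total_degree_add total_degree_single one_add_one)
  then obtain u v where "m = pair_mon u v" using degree_two_pair_mon by blast
  moreover have "f = Poly_Mapping.keys (polarize m)"
    unfolding eq ab(1) by (simp add: keys_add_nat insert_commute)
  ultimately show ?thesis using mI by blast
qed

lemma edge_of_polarizationI:
  assumes "monomial (pair_mon u v) \<in> I" "u \<noteq> v"
  shows "{(u, 1), (v, 1)} \<in> edges (graph_of_ideal (polar_vars X I) (polarization X I))"
proof -
  let ?R = "poly_ring (polar_vars X I) :: (('v \<times> nat \<Rightarrow>\<^sub>0 nat) \<Rightarrow>\<^sub>0 'k) ring"
  interpret cring ?R by (rule cring_poly_ring)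
  have deg: "2 \<le> total_degree (polarize m)" if "m \<in> min_gens I" for m
    using that degree_ge_two by (simp add: min_gens_def total_degree_polarize)
  have "pair_mon u v \<in> min_gens I"
    unfolding min_gens_def
  proof (intro CollectI conjI allI impI assms(1))
    fix n assume n: "monomial n \<in> I" "mon_dvd n (pair_mon u v)"
    show "n = pair_mon u v"
      using degree_ge_two[OF n(1)] by (intro mon_dvd_degree_eq[OF n(2)]) (simp add: total_degree_add)
  qed
  moreover have "(\<lambda>m. monomial (polarize m)) ` min_gens I \<subseteq> carrier ?R"
    by (auto simp: polar_vars_def)
  ultimately have "monomial (polarize (pair_mon u v)) \<in> polarization X I"
    unfolding polarization_def using genideal_self by blast
  moreover have "n = polarize (pair_mon u v)"
    if n: "monomial n \<in> polarization X I" "mon_dvd n (polarize (pair_mon u v))" for n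
  proof -
    obtain m where m: "m \<in> min_gens I" "mon_dvd (polarize m) n"
      using polarization_dvd[OF n(1)] by blast
    then have "2 \<le> total_degree n" using deg[OF m(1)] mon_dvd_degree le_trans by blast
    then show ?thesis
      using n(2) by (intro mon_dvd_degree_eq) (auto simp: total_degree_polarize total_degree_add)
  qed
  ultimately have "polarize (pair_mon u v) \<in> min_gens (polarization X I)"
    unfolding min_gens_def by blast
  then show ?thesis
    unfolding polarize_pair[OF assms(2)] graph_of_ideal_def using assms(2) by auto
qed

end


section \<open>The induced matching number\<close>

lemma induced_matching_number_le:
  assumes fin: "finite (edges H)" "finite (edges G)"
    and le: "\<And>M. induced_matching H M \<Longrightarrow> \<exists>M'. induced_matching G M' \<and> card M' = card M"
  shows "induced_matching_number H \<le> induced_matching_number G"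
proof -
  have finite: "finite {card M | M. induced_matching K M}" if "finite (edges K)" for K :: "'c ugraph"
  proof -
    have "{card M | M. induced_matching K M} \<subseteq> card ` Pow (edges K)"
      by (auto simp: induced_matching_def)
    then show ?thesis using that finite_subset by blast
  qed
  have "induced_matching H {}" by (simp add: induced_matching_def)
  then have "{card M | M. induced_matching H M} \<noteq> {}" by blast
  moreover have "{card M | M. induced_matching H M} \<subseteq> {card M | M. induced_matching G M}"
    using le by force
  ultimately show ?thesis
    unfolding induced_matching_number_def using finite[OF fin(2)] by (intro Max_mono)
qed

text \<open>The intersection of an edge of the polarized graph with the original vertices \<open>(x, 1)\<close>.
  Defined as an intersection, it visibly respects disjointness; on edges it agrees with the
  projection that forgets the polarization index.\<close>

definition base :: "('v \<times> nat) set \<Rightarrow> 'v set" where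
  "base f = {x. (x, 1) \<in> f}"

lemma base_keys_polarize [simp]: "base (Poly_Mapping.keys (polarize m)) = Poly_Mapping.keys m"
  by (auto simp: base_def keys_polarize in_keys_iff)

theorem proposition4p4:
  fixes G :: "'v ugraph"
    and s :: nat
    and e :: "nat \<Rightarrow> 'v set"
    and J :: "(('v \<Rightarrow>\<^sub>0 nat) \<Rightarrow>\<^sub>0 'k::field) set"
    and G' :: "('v \<times> nat) ugraph"
  assumes "simple_graph G"
    and "s \<ge> 1"
    and "\<And>i. i \<in> {1..s} \<Longrightarrow> e i \<in> edges G"
    and "J = ideal_colon (poly_ring (verts G))
               (ideal_power (poly_ring (verts G)) (edge_ideal G) (s + 1))
               (\<Prod>i=1..s. edge_mon (e i))"
    and "G' = graph_of_ideal (polar_vars (verts G) J) (polarization (verts G) J)"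
  shows "induced_matching_number G' \<le> induced_matching_number G"
proof -
  define A where "A = image_mset e (mset_set {1..s})"
  have A: "set_mset A \<subseteq> edges G" "size A = s" using assms(3) by (auto simp: A_def)
  have "(\<Prod>i\<in>S. edge_mon (e i)) =
      (monomial (\<Sum>i\<in>S. edge_exp (e i)) :: ('v \<Rightarrow>\<^sub>0 nat) \<Rightarrow>\<^sub>0 'k)" if "S \<subseteq> {1..s}" for S
    using finite_subset[OF that finite_atLeastAtMost] that
  proof (induction S rule: finite_induct)
    case empty
    show ?case by (simp add: monomial_def)
  next
    case (insert i S)
    then show ?case
      by (simp add: monomial_mult edge_mon_monomial[OF assms(1) assms(3)])
  qed
  from this[of "{1..s}"] have "(\<Prod>i=1..s. edge_mon (e i)) =
      (monomial (\<Sum>f\<in>#A. edge_exp f) :: ('v \<Rightarrow>\<^sub>0 nat) \<Rightarrow>\<^sub>0 'k)"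
    by (simp add: A_def sum_unfold_sum_mset image_mset.compositionality comp_def)
  then have J: "J = ideal_colon (poly_ring (verts G))
      (ideal_power (poly_ring (verts G)) (edge_ideal G) (Suc (size A)))
      (monomial (\<Sum>f\<in>#A. edge_exp f))"
    using assms(4) A(2) by simp
  define R where "R = even_connected (edges G) A"
  note degree = colon_degree_ge_two[OF assms(1) A(1) J]
  have pair: "monomial (pair_mon u v) \<in> J \<longleftrightarrow> R u v" for u v
    unfolding R_def by (rule pair_in_colon_iff[OF assms(1) A(1) J])
  have edgeD: "\<exists>u v. R u v \<and> f = Poly_Mapping.keys (polarize (pair_mon u v))"
    if "f \<in> edges G'" for f
    using edge_of_polarizationD[OF degree that[unfolded assms(5)]] unfolding pair .
  have edgeI: "{(u, 1), (v, 1)} \<in> edges G'" if "R u v" "u \<noteq> v" for u v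
    unfolding assms(5) using that by (intro edge_of_polarizationI[OF degree]) (simp_all only: pair not_False_eq_True)
  have finV: "finite (verts G)" and subV: "edges G \<subseteq> Pow (verts G)"
    using assms(1) by (auto simp: simple_graph_def)
  have finG: "finite (edges G)" using finite_subset[OF subV] finV by simp
  have RV: "u \<in> verts G \<and> v \<in> verts G" if "R u v" for u v
  proof -
    have "monomial (pair_mon u v) \<in> carrier (poly_ring (verts G) :: (('v \<Rightarrow>\<^sub>0 nat) \<Rightarrow>\<^sub>0 'k) ring)"
      using that unfolding pair[symmetric] J ideal_colon_def by blast
    then show ?thesis by (simp add: keys_add_nat)
  qed
  \<comment> \<open>There must be finitely many matchings for their maximal size to be meaningful.\<close>
  have "edges G' \<subseteq> (\<lambda>(u, v). Poly_Mapping.keys (polarize (pair_mon u v))) ` (verts G \<times> verts G)"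
  proof
    fix f assume "f \<in> edges G'"
    from edgeD[OF this] obtain u v where "R u v" "f = Poly_Mapping.keys (polarize (pair_mon u v))"
      by (elim exE conjE)
    then show "f \<in> (\<lambda>(u, v). Poly_Mapping.keys (polarize (pair_mon u v))) ` (verts G \<times> verts G)"
      using RV by (intro image_eqI[of _ _ "(u, v)"]) simp_all
  qed
  then have finG': "finite (edges G')" by (rule finite_subset) (simp add: finV)
  show ?thesis
  proof (rule induced_matching_number_le[OF finG' finG])
    fix M assume M: "induced_matching G' M"
    have base: "\<exists>u v. base f = {u, v} \<and> R u v" if f: "f \<in> M" for f
    proof -
      obtain u v where "R u v" "f = Poly_Mapping.keys (polarize (pair_mon u v))"
        using edgeD[of f] f M unfolding induced_matching_def by (meson subsetD)
      then show ?thesis by (intro exI[of _ u] exI[of _ v]) (auto simp: keys_add_nat)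
    qed
    have disj: "base f \<inter> base g = {}" if "f \<in> M" "g \<in> M" "f \<noteq> g" for f g
      using M that unfolding induced_matching_def base_def by blast
    have "inj_on base M"
    proof (rule inj_onI, rule ccontr)
      fix f g assume fg: "f \<in> M" "g \<in> M" "base f = base g" "f \<noteq> g"
      then have "base f = {}" using disj by auto
      then show False using base[OF fg(1)] by auto
    qed
    then have card: "card (base ` M) = card M" by (rule card_image)
    have "rel_matching R (base ` M)"
      unfolding rel_matching_def ball_simps
    proof (intro conjI ballI impI)
      fix f assume "f \<in> M"
      then show "\<exists>u v. base f = {u, v} \<and> R u v" by (rule base)
    next
      fix f g assume fg: "f \<in> M" "g \<in> M" "base f \<noteq> base g"
      then have "f \<noteq> g" by blast
      then show dis: "base f \<inter> base g = {}" using disj fg by blast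
      fix x y assume xy: "x \<in> base f" "y \<in> base g"
      have "{(x, 1), (y, 1)} \<notin> edges G'"
        using M fg(1,2) \<open>f \<noteq> g\<close> xy unfolding induced_matching_def base_def by blast
      moreover have "x \<noteq> y" using dis xy by blast
      ultimately show "\<not> R x y" using edgeI by blast
    qed
    moreover have "finite (base ` M)"
      using M finite_subset[OF _ finG'] unfolding induced_matching_def by simp
    ultimately have "\<exists>M'\<subseteq>edges G. rel_matching R M' \<and> card M' = card (base ` M) + card ({} :: 'v set set)"
      unfolding R_def
      by (intro rel_matching_to_edges[OF even_connected_sym even_connected_edge
            even_connected_exchange]) simp_all
    then obtain M' where M': "M' \<subseteq> edges G" "rel_matching R M'" "card M' = card M"
      by (auto simp: card)
    have "induced_matching G M'"
      unfolding induced_matching_def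
    proof (intro conjI ballI impI M'(1))
      fix f g assume fg: "f \<in> M'" "g \<in> M'" "f \<noteq> g"
      show "f \<inter> g = {}" using rel_matchingD(2)[OF M'(2) fg] .
      fix x y assume "x \<in> f" "y \<in> g"
      then have "\<not> R x y" by (rule rel_matchingD(3)[OF M'(2) fg])
      then show "{x, y} \<notin> edges G" unfolding R_def using even_connected_edge[of x y] by metis
    qed
    then show "\<exists>M'. induced_matching G M' \<and> card M' = card M" using M'(3) by blast
  qed
qed

end
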